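(* Assume $(A,Z)$ is an evanescent $m$-pair, $a\in A$, and $W\subset\mathbb{R}^{\mathbb{N}}$. Then (a) if $W$ is $f$-ordinary, then $W\cap\mathrm{Sol}_\infty(E)\subset\Delta^{-m}b+Z$; (b) if $W$ is $f$-regular, then $W\cap\Delta^{-m}b\subset\mathrm{Sol}_\infty(E)+Z$; (c) if $W$ is $f$-regular and $Z$-invariant, then $$(W\cap\mathrm{Sol}_\infty(E))+Z=(W\cap\Delta^{-m}b)+Z.$$
   Context: $\mathbb{N}$ is the set of positive integers and $\mathbb{R}^{\mathbb{N}}$ is the real vector space of all real sequences $x:\mathbb{N}\to\mathbb{R}$. For $x\in\mathbb{R}^{\mathbb{N}}$, $\Delta x_n=x_{n+1}-x_n$ and $\Delta^m$ is the $m$-th iterate of $\Delta$. Standing assumptions: $m\in\mathbb{N}$, $f:\mathbb{R}\to\mathbb{R}$, $\sigma:\mathbb{N}\to\mathbb{N}$ with $\lim_{n\to\infty}\sigma(n)=\infty$, and $a,b\in\mathbb{R}^{\mathbb{N}}$. The equation (E) is $$\Delta^m x_n=a_nf(x_{\sigma(n)})+b_n .$$ A sequence $x$ is a solution of (E) if there is $p\in\mathbb{N}$ such that the equality (E) holds for every $n\ge p$. $\mathrm{Sol}_\infty(E)$ denotes the set of all solutions. $\Delta^{-m}b=\{y\in\mathbb{R}^{\mathbb{N}}:\Delta^m y=b\}$. Sums of sets of sequences are $X+Y=\{x+y:x\in X,\ y\in Y\}$. $\mathrm{Fin}$ is the space of sequences with only finitely many nonzero terms, $\mathrm{O}(1)$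 the space of bounded sequences, $\mathrm{o}(1)$ the space of sequences convergent to $0$. Products of sequences are pointwise. An $m$-pair is a pair $(A,Z)$ of linear subspaces of $\mathbb{R}^{\mathbb{N}}$ such that $\mathrm{Fin}\subset Z$, $u\alpha\in A$ for all $u\in\mathrm{O}(1)$ and $\alpha\in A$, and $A\subset\Delta^mZ=\{\Delta^mz:z\in Z\}$. An $m$-pair $(A,Z)$ is evanescent if $Z\subset\mathrm{o}(1)$. A set $W\subset\mathbb{R}^{\mathbb{N}}$ is $Z$-invariant if $W+Z\subset W$. A set $U\subset\mathbb{R}$ is a uniform neighbourhood of $Y\subset\mathbb{R}$ if there is $\varepsilon>0$ such that $[y-\varepsilon,y+\varepsilon]\subset U$ for every $y\in Y$. A set $W\subset\mathbb{R}^{\mathbb{N}}$ is $f$-ordinary if for every $x\in W$ the sequence $f\circ x$ is bounded. $W$ is $f$-regular if for every $x\in W$ there is an index $p$ such that $f$ is continuous and bounded on some uniform neighbourhood of the set $\{x_n:n\ge p\}$. *)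

theory Defs
  imports "HOL-Analysis.Analysis" "HOL-Library.Function_Algebras" "HOL-Library.Set_Algebras"
begin

text \<open>Sequences indexed by the positive integers are modelled as functions on \<^typ>\<open>nat\<close>:
  the argument \<open>k\<close> stands for the index \<open>k + 1\<close>.  The index enters only through successors and
  through "for all sufficiently large indices", so nothing depends on where the indexing starts.
  Sums and products of sequences are the pointwise ones of \<^theory>\<open>HOL-Library.Function_Algebras\<close>,
  sums of sets of sequences those of \<^theory>\<open>HOL-Library.Set_Algebras\<close>.\<close>

type_synonym rseq = "nat \<Rightarrow> real"

global_interpretation rseq: vector_space "\<lambda>(c::real) (x::rseq) n. c * x n"
  by unfold_locales (auto simp: fun_eq_iff algebra_simps)

definition fdiff :: "rseq \<Rightarrow> rseq" where
  "fdiff x = (\<lambda>n. x (Suc n) - x n)"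

definition Fin_seq :: "rseq set" where
  "Fin_seq = {x. finite {n. x n \<noteq> 0}}"

definition bounded_seqs :: "rseq set" where
  "bounded_seqs = {x. Bseq x}"

definition null_seqs :: "rseq set" where
  "null_seqs = {x. x \<longlonglongrightarrow> 0}"

definition m_pair :: "nat \<Rightarrow> rseq set \<Rightarrow> rseq set \<Rightarrow> bool" where
  "m_pair m A Z \<longleftrightarrow>
     rseq.subspace A \<and> rseq.subspace Z \<and> Fin_seq \<subseteq> Z \<and>
     (\<forall>u\<in>bounded_seqs. \<forall>\<alpha>\<in>A. u * \<alpha> \<in> A) \<and>
     A \<subseteq> (fdiff ^^ m) ` Z"

definition evanescent_m_pair :: "nat \<Rightarrow> rseq set \<Rightarrow> rseq set \<Rightarrow> bool" where
  "evanescent_m_pair m A Z \<longleftrightarrow> m_pair m A Z \<and> Z \<subseteq> null_seqs"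

definition invariant_under :: "rseq set \<Rightarrow> rseq set \<Rightarrow> bool" where
  "invariant_under Z W \<longleftrightarrow> W + Z \<subseteq> W"

definition fdiff_preimage :: "nat \<Rightarrow> rseq \<Rightarrow> rseq set" where
  "fdiff_preimage m b = {y. (fdiff ^^ m) y = b}"

text \<open>The solutions \<open>x\<close> of \<open>\<Delta>\<^sup>m x\<^sub>n = a\<^sub>n f(x\<^bsub>\<sigma>(n)\<^esub>) + b\<^sub>n\<close>, required only from some index on.\<close>

definition Sol_inf ::
  "nat \<Rightarrow> rseq \<Rightarrow> (real \<Rightarrow> real) \<Rightarrow> (nat \<Rightarrow> nat) \<Rightarrow> rseq \<Rightarrow> rseq set" where
  "Sol_inf m a f \<sigma> b =
     {x. \<exists>p. \<forall>n\<ge>p. (fdiff ^^ m) x n = a n * f (x (\<sigma> n)) + b n}"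

definition uniform_nbhd :: "real set \<Rightarrow> real set \<Rightarrow> bool" where
  "uniform_nbhd U Y \<longleftrightarrow> (\<exists>\<epsilon>>0. \<forall>y\<in>Y. {y - \<epsilon>..y + \<epsilon>} \<subseteq> U)"

definition ordinary :: "(real \<Rightarrow> real) \<Rightarrow> rseq set \<Rightarrow> bool" where
  "ordinary f W \<longleftrightarrow> (\<forall>x\<in>W. f \<circ> x \<in> bounded_seqs)"

definition regular :: "(real \<Rightarrow> real) \<Rightarrow> rseq set \<Rightarrow> bool" where
  "regular f W \<longleftrightarrow>
     (\<forall>x\<in>W. \<exists>p U. uniform_nbhd U (x ` {p..}) \<and> continuous_on U f \<and> bounded (f ` U))"

end

theory Submission
  imports Defs
begin

text \<open>If \<open>\<zeta> \<in> Z\<close> satisfies \<open>\<Delta>\<^sup>m \<zeta> = \<bar>a\<bar>\<close>, then every null sequence \<open>z\<close> with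
  \<open>\<Delta>\<^sup>m z = a u\<close> and \<open>\<bar>u\<bar> \<le> M\<close> obeys \<open>\<bar>z\<bar> \<le> M \<bar>\<zeta>\<bar>\<close>, because a null sequence whose \<open>m\<close>-th
  difference is nonnegative has constant sign \<open>(-1)\<^sup>m\<close>.  Hence, for \<open>\<Delta>\<^sup>m y = b\<close>, sending \<open>z\<close> to a
  solution \<open>z' \<in> Z\<close> of \<open>\<Delta>\<^sup>m z' = a (f \<circ> (y + z) \<circ> \<sigma>)\<close> maps the compact box
  \<open>\<bar>z\<bar> \<le> M \<bar>\<zeta>\<bar>\<close> continuously into itself for the product topology, and a fixed point \<open>z\<close> makes
  \<open>y + z\<close> a solution of (E).  The fixed point comes from Kuhn's combinatorial lemma in
  dimension \<open>k\<close> with mesh \<open>1/k\<close>, letting \<open>k\<close> tend to infinity.\<close>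

subsection \<open>A fixed point theorem for the Hilbert cube\<close>

lemma tendsto_componentwise_iff:
  fixes X :: "'c \<Rightarrow> 'a \<Rightarrow> 'b::topological_space"
  shows "(X \<longlongrightarrow> l) F \<longleftrightarrow> (\<forall>i. ((\<lambda>c. X c i) \<longlongrightarrow> l i) F)"
  using limitin_componentwise[of "\<lambda>_. euclidean" "UNIV :: 'a set" X l F]
  by (simp add: euclidean_product_topology)

text \<open>Label each grid point, coordinate by coordinate, by the direction in which
  \<open>F\<close> pushes it. Kuhn's lemma finds one small grid cube in which every coordinate
  \<open>i < p\<close> sees both labels. Its base corner serves as \<open>w\<close>, and two of its
  vertices carrying different labels at \<open>i\<close> serve as \<open>r\<close> and
  \<open>s\<close>.\<close>

lemma kuhn_approximate_fixpoint:
  fixes lo hi :: rseq and F :: "rseq \<Rightarrow> rseq"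
  assumes le: "\<And>i. lo i \<le> hi i"
    and maps: "\<And>v. v \<in> PiE UNIV (\<lambda>i. {lo i..hi i}) \<Longrightarrow> F v \<in> PiE UNIV (\<lambda>i. {lo i..hi i})"
    and p: "0 < p"
  obtains w where "w \<in> PiE UNIV (\<lambda>i. {lo i..hi i})"
    and "\<And>i. i < p \<Longrightarrow> \<exists>r s. r \<in> PiE UNIV (\<lambda>i. {lo i..hi i}) \<and> s \<in> PiE UNIV (\<lambda>i. {lo i..hi i}) \<and>
           (\<forall>j. \<bar>r j - w j\<bar> \<le> (hi j - lo j) / real p) \<and> (\<forall>j. \<bar>s j - w j\<bar> \<le> (hi j - lo j) / real p) \<and>
           r i \<le> F r i \<and> F s i \<le> s i"
proof -
  let ?K = "PiE UNIV (\<lambda>i. {lo i..hi i})"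
  \<comment> \<open>The number \<open>p\<close> is both the dimension and the number of subdivisions
    of an edge. Coordinates from \<open>p\<close> on are frozen at \<open>lo\<close>, so all grid
    points agree there.\<close>
  define pt where "pt x = (\<lambda>i. lo i + (if i < p then (hi i - lo i) * (real (x i) / real p) else 0))"
    for x :: "nat \<Rightarrow> nat"
  have ptK: "pt x \<in> ?K" if "\<forall>i<p. x i \<le> p" for x
  proof -
    have "0 \<le> (hi i - lo i) * (real (x i) / real p)"
         "(hi i - lo i) * (real (x i) / real p) \<le> hi i - lo i" if i: "i < p" for i
    proof -
      have "real (x i) / real p \<le> 1" using \<open>\<forall>i<p. x i \<le> p\<close> i p by simp
      then show "(hi i - lo i) * (real (x i) / real p) \<le> hi i - lo i"
        using le[of i] by (intro mult_left_le) simp_all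
      show "0 \<le> (hi i - lo i) * (real (x i) / real p)" using le[of i] by simp
    qed
    note bounds = this
    have "lo i \<le> pt x i \<and> pt x i \<le> hi i" for i
      using bounds[of i] le[of i] by (cases "i < p") (simp_all add: pt_def)
    then show ?thesis by auto
  qed
  have pt_near: "\<bar>pt x j - pt q j\<bar> \<le> (hi j - lo j) / real p" if "\<forall>j<p. q j \<le> x j \<and> x j \<le> q j + 1" for x q j
  proof (cases "j < p")
    case True
    have "pt x j - pt q j = (hi j - lo j) * ((real (x j) - real (q j)) / real p)"
      using True by (simp add: pt_def algebra_simps diff_divide_distrib)
    moreover have "\<bar>(real (x j) - real (q j)) / real p\<bar> \<le> 1 / real p"
      using that True p by (auto simp: abs_le_iff intro!: divide_right_mono)
    ultimately show ?thesis
      using le[of j] mult_left_mono[of "\<bar>(real (x j) - real (q j)) / real p\<bar>" "1 / real p" "hi j - lo j"]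
      by (simp add: abs_mult)
  next
    case False
    then show ?thesis using le[of j] by (simp add: pt_def)
  qed
  \<comment> \<open>Kuhn's lemma prescribes 0 on the faces \<open>x i = 0\<close> and 1 on the faces
    \<open>x i = p\<close>. There the matching inequality between \<open>pt x\<close> and
    \<open>F (pt x)\<close> comes from \<open>F\<close> mapping the box into itself.\<close>
  define label :: "(nat \<Rightarrow> nat) \<Rightarrow> nat \<Rightarrow> nat"
    where "label x i = (if x i = p \<or> (x i \<noteq> 0 \<and> F (pt x) i < pt x i) then 1 else 0)" for x i
  obtain q where q: "\<forall>i<p. q i < p" and
    qrs: "\<forall>i<p. \<exists>r s. (\<forall>j<p. q j \<le> r j \<and> r j \<le> q j + 1) \<and>
            (\<forall>j<p. q j \<le> s j \<and> s j \<le> q j + 1) \<and> label r i \<noteq> label s i"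
    by (rule kuhn_lemma[of p p label]) (use p in \<open>auto simp: label_def\<close>)
  have label0: "pt x i \<le> F (pt x) i" if "label x i = 0" "\<forall>j<p. x j \<le> p" "i < p" for x i
  proof (cases "x i = 0")
    case True
    then have "pt x i = lo i" by (simp add: pt_def)
    then show ?thesis using maps[OF ptK[OF that(2)]] by (auto simp: PiE_iff)
  qed (use that in \<open>auto simp: label_def split: if_splits\<close>)
  have label1: "F (pt x) i \<le> pt x i" if "label x i \<noteq> 0" "\<forall>j<p. x j \<le> p" "i < p" for x i
  proof (cases "x i = p")
    case True
    then have "pt x i = hi i" using that p by (simp add: pt_def)
    then show ?thesis using maps[OF ptK[OF that(2)]] by (auto simp: PiE_iff)
  qed (use that in \<open>auto simp: label_def split: if_splits\<close>)
  show thesis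
  proof
    show "pt q \<in> ?K" using q by (intro ptK) auto
    fix i assume i: "i < p"
    obtain r s where r: "\<forall>j<p. q j \<le> r j \<and> r j \<le> q j + 1"
      and s: "\<forall>j<p. q j \<le> s j \<and> s j \<le> q j + 1" and ne: "label r i \<noteq> label s i"
      using qrs i by blast
    have rp: "\<forall>j<p. r j \<le> p" and sp: "\<forall>j<p. s j \<le> p"
      using r s q by (metis Suc_eq_plus1 Suc_leI le_trans)+
    show "\<exists>r s. r \<in> ?K \<and> s \<in> ?K \<and>
           (\<forall>j. \<bar>r j - pt q j\<bar> \<le> (hi j - lo j) / real p) \<and> (\<forall>j. \<bar>s j - pt q j\<bar> \<le> (hi j - lo j) / real p) \<and>
           r i \<le> F r i \<and> F s i \<le> s i"
    proof (cases "label r i = 0")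
      case True
      then have "pt r i \<le> F (pt r) i" "F (pt s) i \<le> pt s i"
        using label0[OF _ rp i] label1[OF _ sp i] ne by simp_all
      then show ?thesis
        using ptK[OF rp] ptK[OF sp] pt_near[OF r] pt_near[OF s]
        by (intro exI[of _ "pt r"] exI[of _ "pt s"] conjI allI)
    next
      case False
      then have "label s i = 0" using ne by (auto simp: label_def split: if_splits)
      then have "pt s i \<le> F (pt s) i" "F (pt r) i \<le> pt r i"
        using label0[OF _ sp i] label1[OF _ rp i] False by simp_all
      then show ?thesis
        using ptK[OF rp] ptK[OF sp] pt_near[OF r] pt_near[OF s]
        by (intro exI[of _ "pt s"] exI[of _ "pt r"] conjI allI)
    qed
  qed
qed

text \<open>Stage \<open>k\<close> treats the first \<open>k + 1\<close> coordinates with mesh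
  \<open>1 / (k + 1)\<close>. Along a convergent subsequence the two vertices belonging to a fixed
  coordinate \<open>i\<close> have the same limit, and continuity turns their opposite inequalities
  into equality at \<open>i\<close>.\<close>

lemma cube_fixpoint:
  fixes lo hi :: rseq and F :: "rseq \<Rightarrow> rseq"
  assumes le: "\<And>i. lo i \<le> hi i"
    and maps: "\<And>v. v \<in> PiE UNIV (\<lambda>i. {lo i..hi i}) \<Longrightarrow> F v \<in> PiE UNIV (\<lambda>i. {lo i..hi i})"
    and cont: "continuous_on (PiE UNIV (\<lambda>i. {lo i..hi i})) F"
  obtains v where "v \<in> PiE UNIV (\<lambda>i. {lo i..hi i})" "F v = v"
proof -
  let ?K = "PiE UNIV (\<lambda>i. {lo i..hi i})"
  define near where "near k w i r s \<longleftrightarrow> r \<in> ?K \<and> s \<in> ?K \<and>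
      (\<forall>j. \<bar>r j - w j\<bar> \<le> (hi j - lo j) / real (Suc k)) \<and>
      (\<forall>j. \<bar>s j - w j\<bar> \<le> (hi j - lo j) / real (Suc k)) \<and>
      r i \<le> F r i \<and> F s i \<le> s i" for k w i and r s :: rseq
  have "\<exists>w. w \<in> ?K \<and> (\<forall>i\<le>k. \<exists>r s. near k w i r s)" for k
  proof (rule kuhn_approximate_fixpoint[of lo hi F "Suc k"])
    fix w
    assume "w \<in> ?K" and "\<And>i. i < Suc k \<Longrightarrow> \<exists>r s. r \<in> ?K \<and> s \<in> ?K \<and>
      (\<forall>j. \<bar>r j - w j\<bar> \<le> (hi j - lo j) / real (Suc k)) \<and>
      (\<forall>j. \<bar>s j - w j\<bar> \<le> (hi j - lo j) / real (Suc k)) \<and>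
      r i \<le> F r i \<and> F s i \<le> s i"
    then show ?thesis unfolding near_def less_Suc_eq_le by blast
  qed (use le maps in auto)
  then obtain w where w: "\<And>k. w k \<in> ?K" and "\<forall>k i. \<exists>r s. i \<le> k \<longrightarrow> near k (w k) i r s"
    by metis
  then obtain r s where rs: "\<And>k i. i \<le> k \<Longrightarrow> near k (w k) i (r k i) (s k i)"
    by metis
  \<comment> \<open>This is Tychonoff's theorem; a convergent subsequence then exists because a
    countable product of lines is first countable.\<close>
  have "compact ?K"
    using compactin_PiE[of "\<lambda>_. euclidean" "UNIV :: nat set" "\<lambda>i. {lo i..hi i}"]
    by (simp add: euclidean_product_topology)
  then obtain v \<phi> where v: "v \<in> ?K" and \<phi>: "strict_mono \<phi>" and lim: "(w \<circ> \<phi>) \<longlonglongrightarrow> v"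
    using w compact_imp_seq_compact unfolding seq_compact_def by metis
  \<comment> \<open>Vertices for coordinate \<open>i\<close> exist only from stage \<open>i\<close>
    on, so \<open>x\<close> is controlled only for \<open>k \<ge> i\<close>. There it is close to
    \<open>w (\<phi> k)\<close> in all coordinates, which gives convergence in the product
    topology.\<close>
  have lim_near: "(\<lambda>k. F (x k) i) \<longlonglongrightarrow> F v i \<and> (\<lambda>k. x k i) \<longlonglongrightarrow> v i"
    if near: "\<And>k. k \<ge> i \<Longrightarrow> x k \<in> ?K \<and> (\<forall>j. \<bar>x k j - w (\<phi> k) j\<bar> \<le> (hi j - lo j) / real (Suc (\<phi> k)))"
    for x i
  proof -
    have "(\<lambda>k. x k j) \<longlonglongrightarrow> v j" for j
    proof -
      have "(\<lambda>k. (hi j - lo j) / real (Suc k)) \<longlonglongrightarrow> 0"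
        by (rule LIMSEQ_Suc) (rule lim_const_over_n)
      then have "(\<lambda>k. (hi j - lo j) / real (Suc (\<phi> k))) \<longlonglongrightarrow> 0"
        using LIMSEQ_subseq_LIMSEQ[OF _ \<phi>] by (force simp: o_def)
      then have "(\<lambda>k. x k j - w (\<phi> k) j) \<longlonglongrightarrow> 0"
        by (rule Lim_null_comparison[rotated])
          (auto intro: eventually_mono[OF eventually_ge_at_top[of i]] simp: near simp del: of_nat_Suc)
      moreover have "(\<lambda>k. w (\<phi> k) j) \<longlonglongrightarrow> v j"
        using lim by (simp add: tendsto_componentwise_iff o_def)
      ultimately have "(\<lambda>k. (x k j - w (\<phi> k) j) + w (\<phi> k) j) \<longlonglongrightarrow> 0 + v j"
        by (rule tendsto_add)
      then show ?thesis by simp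
    qed
    then have x: "x \<longlonglongrightarrow> v" by (simp add: tendsto_componentwise_iff)
    have "(\<lambda>k. F (x k)) \<longlonglongrightarrow> F v"
      by (rule continuous_on_tendsto_compose[OF cont x v])
        (use near in \<open>auto intro: eventually_mono[OF eventually_ge_at_top[of i]]\<close>)
    with x show ?thesis by (simp add: tendsto_componentwise_iff)
  qed
  have "F v i = v i" for i
  proof (rule antisym)
    have ge: "i \<le> \<phi> k" if "k \<ge> i" for k
      using seq_suble[OF \<phi>, of k] that by linarith
    show "F v i \<le> v i"
      using lim_near[of i "\<lambda>k. s (\<phi> k) i"] rs[OF ge] unfolding near_def
      by (intro LIMSEQ_le[of "\<lambda>k. F (s (\<phi> k) i) i" _ "\<lambda>k. s (\<phi> k) i i"]) (blast+)
    show "v i \<le> F v i"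
      using lim_near[of i "\<lambda>k. r (\<phi> k) i"] rs[OF ge] unfolding near_def
      by (intro LIMSEQ_le[of "\<lambda>k. r (\<phi> k) i i" _ "\<lambda>k. F (r (\<phi> k) i) i"]) (blast+)
  qed
  then show thesis using that v by blast
qed

subsection \<open>Iterated differences of null sequences\<close>

lemma funpow_fdiff_Suc: "(fdiff ^^ Suc m) z = (fdiff ^^ m) (fdiff z)"
  by (simp add: funpow_Suc_right del: funpow.simps)

lemma funpow_fdiff_add: "(fdiff ^^ m) (x + y) = (fdiff ^^ m) x + (fdiff ^^ m) y"
  by (induction m) (auto simp: fdiff_def fun_eq_iff)

lemma funpow_fdiff_diff: "(fdiff ^^ m) (x - y) = (fdiff ^^ m) x - (fdiff ^^ m) y"
  by (induction m) (auto simp: fdiff_def fun_eq_iff)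

lemma funpow_fdiff_mult: "(fdiff ^^ m) (\<lambda>n. c * x n) = (\<lambda>n. c * (fdiff ^^ m) x n)"
  by (induction m) (auto simp: fdiff_def fun_eq_iff algebra_simps)

lemma fdiff_null: "z \<longlonglongrightarrow> 0 \<Longrightarrow> fdiff z \<longlonglongrightarrow> 0"
  unfolding fdiff_def using tendsto_diff[OF LIMSEQ_Suc, of z 0 z 0] by simp

text \<open>By induction \<open>fdiff z\<close> has the sign \<open>(-1) ^ m\<close>, so
  \<open>(-1) ^ Suc m * z\<close> decreases. Its limit is 0, hence it is nonnegative.\<close>

lemma null_funpow_fdiff_sign:
  assumes "z \<longlonglongrightarrow> 0" "\<And>n. 0 \<le> (fdiff ^^ m) z n"
  shows "0 \<le> (-1) ^ m * z n"
  using assms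
proof (induction m arbitrary: z n)
  case (Suc m)
  have "0 \<le> (-1) ^ m * fdiff z n" for n
    using Suc.prems by (intro Suc.IH fdiff_null) (simp_all add: funpow_fdiff_Suc del: funpow.simps)
  then have "decseq (\<lambda>n. (-1) ^ Suc m * z n)"
    by (intro decseq_SucI) (simp add: fdiff_def algebra_simps)
  moreover have "(\<lambda>n. (-1) ^ Suc m * z n) \<longlonglongrightarrow> 0"
    using tendsto_mult_right_zero[OF Suc.prems(1)] .
  ultimately show ?case by (rule decseq_ge)
qed simp

text \<open>Both \<open>w + z\<close> and \<open>w - z\<close> have nonnegative \<open>m\<close>-th
  difference, so the sign lemma applies to each. The bound needs \<open>\<bar>w n\<bar>\<close>
  because \<open>w\<close> is nonpositive when \<open>m\<close> is odd.\<close>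

lemma null_funpow_fdiff_dominated:
  assumes z: "z \<longlonglongrightarrow> 0" and w: "w \<longlonglongrightarrow> 0"
    and le: "\<And>n. \<bar>(fdiff ^^ m) z n\<bar> \<le> (fdiff ^^ m) w n"
  shows "\<bar>z n\<bar> \<le> \<bar>w n\<bar>"
proof -
  have "(w + z) \<longlonglongrightarrow> 0" "(w - z) \<longlonglongrightarrow> 0"
    using tendsto_add[OF w z] tendsto_diff[OF w z] by (auto simp: plus_fun_def fun_diff_def)
  moreover have "0 \<le> (fdiff ^^ m) (w + z) k" "0 \<le> (fdiff ^^ m) (w - z) k" for k
    using le[of k] by (auto simp: funpow_fdiff_add funpow_fdiff_diff)
  ultimately have "0 \<le> (-1) ^ m * (w + z) n" "0 \<le> (-1) ^ m * (w - z) n"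
    by (blast intro: null_funpow_fdiff_sign)+
  then show ?thesis
    by (cases "even m") (auto simp: abs_if)
qed

text \<open>A form of continuity for inverting \<open>fdiff ^^ m\<close>, from which the fixed point
  map gets its continuity. In the induction the differences are dominated by
  \<open>c (Suc n) + c n\<close>; one summation then recovers \<open>X k\<close>.\<close>

lemma dominated_funpow_fdiff_tendsto:
  fixes X :: "'a \<Rightarrow> rseq"
  assumes "c \<longlonglongrightarrow> 0" "\<And>k n. \<bar>X k n\<bar> \<le> c n" "\<And>n. ((\<lambda>k. (fdiff ^^ m) (X k) n) \<longlongrightarrow> 0) F"
  shows "((\<lambda>k. X k n) \<longlongrightarrow> 0) F"
  using assms
proof (induction m arbitrary: c X n)
  case (Suc m)
  have diff0: "((\<lambda>k. fdiff (X k) n) \<longlongrightarrow> 0) F" for n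
  proof (rule Suc.IH[of "\<lambda>n. c (Suc n) + c n"])
    show "(\<lambda>n. c (Suc n) + c n) \<longlonglongrightarrow> 0"
      using tendsto_add[OF LIMSEQ_Suc[OF Suc.prems(1)] Suc.prems(1)] by simp
    show "\<bar>fdiff (X k) n\<bar> \<le> c (Suc n) + c n" for k n
      using Suc.prems(2)[of k n] Suc.prems(2)[of k "Suc n"] by (auto simp: fdiff_def)
    show "((\<lambda>k. (fdiff ^^ m) (fdiff (X k)) n) \<longlongrightarrow> 0) F" for n
      using Suc.prems(3) by (simp add: funpow_fdiff_Suc del: funpow.simps)
  qed
  show ?case
  proof (rule tendstoI)
    fix e :: real assume e: "0 < e"
    \<comment> \<open>The common bound \<open>c\<close> makes \<open>N\<close> independent of
      \<open>k\<close>. Thus \<open>X k n\<close> is a uniformly small term minus a sum of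
      \<open>N\<close> terms, each tending to 0.\<close>
    then obtain N where N: "\<And>n. n \<ge> N \<Longrightarrow> \<bar>c n\<bar> < e / 2"
      using Suc.prems(1) unfolding lim_sequentially by (metis half_gt_zero dist_0_norm dist_commute real_norm_def)
    define S where "S k = (\<Sum>i<N. fdiff (X k) (n + i))" for k
    have tel: "S k = X k (n + N) - X k n" for k
      unfolding S_def fdiff_def using sum_lessThan_telescope[of "\<lambda>i. X k (n + i)" N] by simp
    have "(S \<longlongrightarrow> 0) F"
      unfolding S_def by (rule tendsto_null_sum) (rule diff0)
    then have "\<forall>\<^sub>F k in F. \<bar>S k\<bar> < e / 2"
      using tendstoD[of S 0 F "e / 2"] e by simp
    then show "\<forall>\<^sub>F k in F. dist (X k n) 0 < e"
    proof eventually_elim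
      case (elim k)
      then show ?case
        using tel[of k] Suc.prems(2)[of k "n + N"] N[of "n + N"] unfolding dist_real_def by linarith
    qed
  qed
qed simp

text \<open>The negative tail sum is an antidifference that vanishes beyond the support.\<close>

lemma Fin_seq_subset_fdiff: "Fin_seq \<subseteq> fdiff ` Fin_seq"
proof
  fix w assume "w \<in> Fin_seq"
  then obtain N where N: "\<And>n. w n \<noteq> 0 \<Longrightarrow> n < N"
    unfolding Fin_seq_def finite_nat_set_iff_bounded by auto
  define z where "z n = - (\<Sum>i=n..<N. w i)" for n
  have "fdiff z n = w n" for n
    using N[of n] by (cases "n < N") (auto simp: fdiff_def z_def sum.atLeast_Suc_lessThan)
  then have "w = fdiff z" by auto
  moreover have "z \<in> Fin_seq"
    unfolding Fin_seq_def by (auto intro!: finite_subset[of _ "{..<N}"] simp: z_def not_le intro: ccontr)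
  ultimately show "w \<in> fdiff ` Fin_seq" by blast
qed

lemma Fin_seq_subset_funpow_fdiff: "Fin_seq \<subseteq> (fdiff ^^ m) ` Fin_seq"
proof (induction m)
  case (Suc m)
  then have "fdiff ` Fin_seq \<subseteq> fdiff ` (fdiff ^^ m) ` Fin_seq" by (rule image_mono)
  with Fin_seq_subset_fdiff show ?case by (simp add: image_comp [symmetric]) blast
qed simp

subsection \<open>Solutions near a sequence with prescribed difference\<close>

text \<open>The fixed point argument for a single \<open>y\<close>. Values of \<open>y + z\<close>
  outside \<open>U\<close> are avoided by truncating the nonlinearity at small indices.\<close>

lemma evanescent_exists_solution_near:
  assumes \<sigma>: "filterlim \<sigma> at_top sequentially"
    and AZ: "evanescent_m_pair m A Z" and a: "a \<in> A"
    and nbhd: "uniform_nbhd U (y ` {p..})" and contf: "continuous_on U f" and bddf: "bounded (f ` U)"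
  obtains z where "z \<in> Z" "y + z \<in> Sol_inf m a f \<sigma> ((fdiff ^^ m) y)"
proof -
  have null: "z \<longlonglongrightarrow> 0" if "z \<in> Z" for z
    using AZ that by (auto simp: evanescent_m_pair_def null_seqs_def)
  have lift: "\<exists>z\<in>Z. (fdiff ^^ m) z = u * a" if "Bseq u" for u
  proof -
    have "u * a \<in> (fdiff ^^ m) ` Z"
      using AZ a that by (auto simp: evanescent_m_pair_def m_pair_def bounded_seqs_def)
    then show ?thesis by auto
  qed
  \<comment> \<open>The bounded multiplier \<open>sgn (a n)\<close> turns \<open>a\<close> into
    \<open>\<bar>a\<bar>\<close>, which therefore also has an antidifference in
    \<open>Z\<close>.\<close>
  obtain \<zeta> where \<zeta>: "\<zeta> \<in> Z" "(fdiff ^^ m) \<zeta> = (\<lambda>n. sgn (a n)) * a"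
  proof -
    have "Bseq (\<lambda>n. sgn (a n))" by (rule BseqI'[of _ 1]) (simp add: abs_sgn_eq)
    then show thesis using lift that by blast
  qed
  then have \<zeta>': "(fdiff ^^ m) \<zeta> n = \<bar>a n\<bar>" for n
    by (simp add: times_fun_def abs_sgn mult.commute)
  obtain M where M: "M > 0" "\<And>t. t \<in> U \<Longrightarrow> \<bar>f t\<bar> \<le> M"
    using bddf unfolding bounded_pos by auto
  define c where "c n = M * \<bar>\<zeta> n\<bar>" for n
  have c0: "c \<longlonglongrightarrow> 0"
    unfolding c_def by (intro tendsto_mult_right_zero tendsto_rabs_zero null \<zeta>)
  \<comment> \<open>Used with \<open>K = M\<close> for the invariance of the box and with
    \<open>K = 2 * M\<close> for continuity.\<close>
  have dominated: "\<bar>z n\<bar> \<le> K * \<bar>\<zeta> n\<bar>"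
    if "z \<longlonglongrightarrow> 0" "(fdiff ^^ m) z = u * a" "\<And>n. \<bar>u n\<bar> \<le> K" for z u K n
  proof -
    have K: "0 \<le> K" using that(3)[of 0] by linarith
    have "\<bar>z n\<bar> \<le> \<bar>K * \<zeta> n\<bar>"
    proof (rule null_funpow_fdiff_dominated[where m = m])
      show "(\<lambda>n. K * \<zeta> n) \<longlonglongrightarrow> 0" by (intro tendsto_mult_right_zero null \<zeta>)
    qed (use that in \<open>auto simp: funpow_fdiff_mult \<zeta>' abs_mult mult_right_mono\<close>)
    then show ?thesis using K by (simp add: abs_mult)
  qed
  obtain \<epsilon> where \<epsilon>: "\<epsilon> > 0" "\<And>n. n \<ge> p \<Longrightarrow> {y n - \<epsilon>..y n + \<epsilon>} \<subseteq> U"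
    using nbhd unfolding uniform_nbhd_def by auto
  \<comment> \<open>From \<open>q\<close> on the box is at most \<open>\<epsilon>\<close> wide on
    either side, so \<open>y + z\<close> stays in \<open>U\<close>, where \<open>f\<close> is
    continuous and bounded by \<open>M\<close>.\<close>
  obtain q where q: "q \<ge> p" "\<And>n. n \<ge> q \<Longrightarrow> c n \<le> \<epsilon>"
  proof -
    have "\<forall>\<^sub>F n in sequentially. c n < \<epsilon>" using c0 \<epsilon>(1) by (rule order_tendstoD)
    then obtain N where "\<And>n. n \<ge> N \<Longrightarrow> c n < \<epsilon>" unfolding eventually_sequentially by auto
    then show thesis using that[of "max p N"] by (auto intro: less_imp_le)
  qed
  let ?K = "PiE UNIV (\<lambda>n. {- c n..c n})"
  have inU: "y n + z n \<in> U" if "z \<in> ?K" "n \<ge> q" for z n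
  proof -
    have "z n \<in> {- c n..c n}" using that(1) by (rule PiE_mem) simp
    then have "\<bar>z n\<bar> \<le> \<epsilon>" using q(2)[OF that(2)] by (simp add: abs_le_iff)
    then have "y n + z n \<in> {y n - \<epsilon>..y n + \<epsilon>}" by (simp add: abs_le_iff)
    then show ?thesis using \<epsilon>(2)[of n] that(2) q(1) by (meson order_trans subsetD)
  qed
  \<comment> \<open>The value 0 replaces \<open>f\<close> where the argument might leave
    \<open>U\<close>. Since \<sigma> tends to infinity, this alters only finitely many
    \<open>n\<close>, which \<open>Sol_inf\<close> tolerates.\<close>
  define g where "g z n = (if \<sigma> n \<ge> q then f (y (\<sigma> n) + z (\<sigma> n)) else 0)" for z :: rseq and n
  have g_bound: "\<bar>g z n\<bar> \<le> M" if "z \<in> ?K" for z n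
    using M inU[OF that] by (auto simp: g_def)
  \<comment> \<open>\<open>T\<close> will pick some antidifference in \<open>Z\<close>. Later
    estimates use only that it is null and has this \<open>m\<close>-th difference, so the arbitrary
    choice does not endanger continuity.\<close>
  have "\<exists>z'. z \<in> ?K \<longrightarrow> z' \<in> Z \<and> (fdiff ^^ m) z' = g z * a" for z
  proof (cases "z \<in> ?K")
    case True
    then have "Bseq (g z)" using g_bound by (intro BseqI'[of _ M]) simp
    then show ?thesis using lift by blast
  qed simp
  then obtain T where T: "\<And>z. z \<in> ?K \<Longrightarrow> T z \<in> Z" "\<And>z. z \<in> ?K \<Longrightarrow> (fdiff ^^ m) (T z) = g z * a"
    by metis
  have cont: "continuous_on ?K T"
  proof (rule continuous_on_sequentiallyI)
    fix X z assume X: "\<forall>k::nat. X k \<in> ?K" and z: "z \<in> ?K" and lim: "X \<longlonglongrightarrow> z"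
    have lim_g: "(\<lambda>k. g (X k) n) \<longlonglongrightarrow> g z n" for n
    proof (cases "\<sigma> n \<ge> q")
      case True
      have "(\<lambda>k. f (y (\<sigma> n) + X k (\<sigma> n))) \<longlonglongrightarrow> f (y (\<sigma> n) + z (\<sigma> n))"
      proof (rule continuous_on_tendsto_compose[OF contf])
        show "(\<lambda>k. y (\<sigma> n) + X k (\<sigma> n)) \<longlonglongrightarrow> y (\<sigma> n) + z (\<sigma> n)"
          using lim by (intro tendsto_intros) (simp add: tendsto_componentwise_iff)
      qed (use X z inU True in auto)
      with True show ?thesis by (simp add: g_def)
    qed (simp add: g_def)
    have diff: "(fdiff ^^ m) (T (X k) - T z) = (g (X k) - g z) * a" for k
      using T X z by (simp add: funpow_fdiff_diff algebra_simps)
    \<comment> \<open>The multipliers \<open>g (X k)\<close> and \<open>g z\<close> differ by at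
      most \<open>2 * M\<close>, so one null sequence dominates all the differences, uniformly in
      \<open>k\<close>.\<close>
    have "(\<lambda>k. (T (X k) - T z) n) \<longlonglongrightarrow> 0" for n
    proof (rule dominated_funpow_fdiff_tendsto[where m = m])
      show "(\<lambda>n. (2 * M) * \<bar>\<zeta> n\<bar>) \<longlonglongrightarrow> 0"
        by (intro tendsto_mult_right_zero tendsto_rabs_zero null \<zeta>)
      show "\<bar>(T (X k) - T z) n\<bar> \<le> (2 * M) * \<bar>\<zeta> n\<bar>" for k n
      proof (rule dominated[OF _ diff])
        show "(T (X k) - T z) \<longlonglongrightarrow> 0"
          using tendsto_diff[OF null[OF T(1)] null[OF T(1)]] X z by (simp add: fun_diff_def)
        show "\<bar>(g (X k) - g z) n\<bar> \<le> 2 * M" for n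
          using g_bound[of "X k" n] g_bound[OF z, of n] X by auto
      qed
      have "(\<lambda>k. (g (X k) n - g z n) * a n) \<longlonglongrightarrow> 0" for n
        by (intro tendsto_mult_left_zero LIM_zero lim_g)
      then show "(\<lambda>k. (fdiff ^^ m) (T (X k) - T z) n) \<longlonglongrightarrow> 0" for n
        by (simp add: diff times_fun_def)
    qed
    then show "(\<lambda>k. T (X k)) \<longlonglongrightarrow> T z"
      by (simp add: tendsto_componentwise_iff LIM_zero_iff)
  qed
  obtain z where z: "z \<in> ?K" "T z = z"
  proof (rule cube_fixpoint[of "\<lambda>n. - c n" c T])
    show "- c n \<le> c n" for n using M by (simp add: c_def)
    show "T v \<in> ?K" if v: "v \<in> ?K" for v
    proof (rule PiE_I)
      fix n
      have "\<bar>T v n\<bar> \<le> c n"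
        unfolding c_def by (rule dominated[OF null[OF T(1)[OF v]] T(2)[OF v] g_bound[OF v]])
      then show "T v n \<in> {- c n..c n}" by (simp add: abs_le_iff)
    qed simp
  qed (use cont in auto)
  obtain N where N: "\<And>n. n \<ge> N \<Longrightarrow> q \<le> \<sigma> n"
    using \<sigma> unfolding filterlim_at_top eventually_sequentially by metis
  have "(fdiff ^^ m) (y + z) n = a n * f ((y + z) (\<sigma> n)) + (fdiff ^^ m) y n" if "n \<ge> N" for n
    using T(2)[OF z(1)] z(2) N[OF that] by (simp add: funpow_fdiff_add g_def)
  then have "y + z \<in> Sol_inf m a f \<sigma> ((fdiff ^^ m) y)"
    unfolding Sol_inf_def by blast
  moreover have "z \<in> Z" using T(1)[OF z(1)] z(2) by simp
  ultimately show thesis using that by blast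
qed

section \<open>From solutions back to sequences with prescribed difference\<close>

lemma regular_imp_ordinary:
  assumes "regular f W"
  shows "ordinary f W"
  unfolding ordinary_def bounded_seqs_def
proof (intro ballI CollectI)
  fix x assume "x \<in> W"
  then obtain p U where U: "uniform_nbhd U (x ` {p..})" "bounded (f ` U)"
    using assms unfolding regular_def by blast
  then have "x n \<in> U" if "n \<ge> p" for n
    using that unfolding uniform_nbhd_def by force
  moreover obtain M where "\<And>t. t \<in> U \<Longrightarrow> norm (f t) \<le> M"
    using U(2) unfolding bounded_iff by auto
  ultimately have "Bseq (\<lambda>n. f (x (n + p)))"
    by (intro BseqI'[of _ M]) simp
  then show "Bseq (f \<circ> x)"
    unfolding o_def by (rule Bseq_offset)
qed

text \<open>Boundedness of \<open>f \<circ> x\<close> puts the nonlinear term into \<open>A\<close>,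
  so it is the \<open>m\<close>-th difference of some \<open>z1\<close> in \<open>Z\<close>.
  Equation (E) may fail at finitely many indices; a finitely supported \<open>z2\<close> repairs
  these, and \<open>Fin_seq \<subseteq> Z\<close>.\<close>

lemma solution_in_preimage_plus:
  assumes AZ: "m_pair m A Z" and a: "a \<in> A"
    and bdd: "Bseq (f \<circ> x)" and sol: "x \<in> Sol_inf m a f \<sigma> b"
  obtains z where "z \<in> Z" "x - z \<in> fdiff_preimage m b"
proof -
  obtain K where K: "\<And>n. norm ((f \<circ> x) n) \<le> K" using bdd by (meson BseqE)
  have "(f \<circ> x \<circ> \<sigma>) \<in> bounded_seqs"
    unfolding bounded_seqs_def using K by (auto intro!: BseqI'[of _ K])
  then have "(f \<circ> x \<circ> \<sigma>) * a \<in> (fdiff ^^ m) ` Z"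
    using AZ a unfolding m_pair_def by blast
  then obtain z1 where z1: "z1 \<in> Z" "(fdiff ^^ m) z1 = (f \<circ> x \<circ> \<sigma>) * a" by auto
  define w where "w = (fdiff ^^ m) x - (fdiff ^^ m) z1 - b"
  obtain p where "\<And>n. n \<ge> p \<Longrightarrow> (fdiff ^^ m) x n = a n * f (x (\<sigma> n)) + b n"
    using sol unfolding Sol_inf_def by auto
  then have "w n = 0" if "n \<ge> p" for n
    using that z1(2) by (simp add: w_def)
  then have "n < p" if "w n \<noteq> 0" for n
    using that not_le by blast
  then have "w \<in> Fin_seq"
    unfolding Fin_seq_def finite_nat_set_iff_bounded by blast
  then obtain z2 where "z2 \<in> Fin_seq" and z2': "(fdiff ^^ m) z2 = w"
    using Fin_seq_subset_funpow_fdiff[of m] by (metis imageE subsetD)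
  then have z2: "z2 \<in> Z"
    using AZ by (auto simp: m_pair_def)
  show thesis
  proof
    show "z1 + z2 \<in> Z" using AZ z1 z2 by (auto simp: m_pair_def intro: rseq.subspace_add)
    show "x - (z1 + z2) \<in> fdiff_preimage m b"
      by (simp add: fdiff_preimage_def funpow_fdiff_diff funpow_fdiff_add z2' w_def)
  qed
qed

theorem theorem5:
  fixes m :: nat and f :: "real \<Rightarrow> real" and \<sigma> :: "nat \<Rightarrow> nat"
    and a b :: rseq and A Z W :: "rseq set"
  assumes "m \<ge> 1"
    and "filterlim \<sigma> at_top sequentially"
    and "evanescent_m_pair m A Z"
    and "a \<in> A"
  shows "(ordinary f W \<longrightarrow> W \<inter> Sol_inf m a f \<sigma> b \<subseteq> fdiff_preimage m b + Z) \<and>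
         (regular f W \<longrightarrow> W \<inter> fdiff_preimage m b \<subseteq> Sol_inf m a f \<sigma> b + Z) \<and>
         (regular f W \<and> invariant_under Z W \<longrightarrow>
            (W \<inter> Sol_inf m a f \<sigma> b) + Z = (W \<inter> fdiff_preimage m b) + Z)"
proof -
  have AZ: "m_pair m A Z" and sub: "rseq.subspace Z"
    using assms(3) by (auto simp: evanescent_m_pair_def m_pair_def)
  have neg: "- z \<in> Z" if "z \<in> Z" for z using rseq.subspace_neg[OF sub that] .
  have add: "z + z' \<in> Z" if "z \<in> Z" "z' \<in> Z" for z z' using rseq.subspace_add[OF sub that] .
  \<comment> \<open>The next two facts move between solutions and the preimage by translations in
    \<open>Z\<close>; the inclusions then follow because \<open>Z\<close> is a subspace.\<close>
  have to_preimage: "\<exists>z\<in>Z. x - z \<in> fdiff_preimage m b"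
    if "ordinary f W" "x \<in> W" "x \<in> Sol_inf m a f \<sigma> b" for x
    using solution_in_preimage_plus[OF AZ assms(4) _ that(3)] that
    unfolding ordinary_def bounded_seqs_def by blast
  have to_solution: "\<exists>z\<in>Z. y + z \<in> Sol_inf m a f \<sigma> b"
    if y: "regular f W" "y \<in> W" "y \<in> fdiff_preimage m b" for y
  proof -
    obtain p U where "uniform_nbhd U (y ` {p..})" "continuous_on U f" "bounded (f ` U)"
      using y(1,2) unfolding regular_def by blast
    from evanescent_exists_solution_near[OF assms(2-4) this] y(3) show ?thesis
      unfolding fdiff_preimage_def by blast
  qed
  show ?thesis
  proof (intro conjI impI)
    show "W \<inter> Sol_inf m a f \<sigma> b \<subseteq> fdiff_preimage m b + Z" if ord: "ordinary f W"
    proof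
      fix x assume "x \<in> W \<inter> Sol_inf m a f \<sigma> b"
      then obtain z where "z \<in> Z" "x - z \<in> fdiff_preimage m b" using to_preimage ord by blast
      then have "(x - z) + z \<in> fdiff_preimage m b + Z" by blast
      then show "x \<in> fdiff_preimage m b + Z" by simp
    qed
    show "W \<inter> fdiff_preimage m b \<subseteq> Sol_inf m a f \<sigma> b + Z" if reg: "regular f W"
    proof
      fix y assume "y \<in> W \<inter> fdiff_preimage m b"
      then obtain z where "z \<in> Z" "y + z \<in> Sol_inf m a f \<sigma> b" using to_solution reg by blast
      then have "(y + z) + (- z) \<in> Sol_inf m a f \<sigma> b + Z" using neg by blast
      then show "y \<in> Sol_inf m a f \<sigma> b + Z" by simp
    qed
    assume "regular f W \<and> invariant_under Z W"
    then have reg: "regular f W" and ord: "ordinary f W"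
      and inv: "\<And>x z. x \<in> W \<Longrightarrow> z \<in> Z \<Longrightarrow> x + z \<in> W"
      using regular_imp_ordinary by (auto simp: invariant_under_def)
    show "(W \<inter> Sol_inf m a f \<sigma> b) + Z = (W \<inter> fdiff_preimage m b) + Z"
    proof (intro equalityI subsetI)
      fix v assume "v \<in> (W \<inter> Sol_inf m a f \<sigma> b) + Z"
      then obtain x z' where x: "x \<in> W" "x \<in> Sol_inf m a f \<sigma> b" "z' \<in> Z" "v = x + z'"
        by (auto elim: set_plus_elim)
      obtain z where z: "z \<in> Z" "x - z \<in> fdiff_preimage m b" using to_preimage[OF ord] x by blast
      \<comment> \<open>Invariance keeps the translated sequence in \<open>W\<close>, and the
        translation is undone by \<open>z + z'\<close>, again in \<open>Z\<close>.\<close>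
      then have "x - z \<in> W" using inv[OF x(1) neg[OF z(1)]] by simp
      then have "(x - z) + (z + z') \<in> (W \<inter> fdiff_preimage m b) + Z" using z x add by blast
      then show "v \<in> (W \<inter> fdiff_preimage m b) + Z" using x by simp
    next
      fix v assume "v \<in> (W \<inter> fdiff_preimage m b) + Z"
      then obtain y z' where y: "y \<in> W" "y \<in> fdiff_preimage m b" "z' \<in> Z" "v = y + z'"
        by (auto elim: set_plus_elim)
      obtain z where z: "z \<in> Z" "y + z \<in> Sol_inf m a f \<sigma> b" using to_solution[OF reg] y by blast
      then have "(y + z) + (- z + z') \<in> (W \<inter> Sol_inf m a f \<sigma> b) + Z"
        using y inv add neg by blast
      then show "v \<in> (W \<inter> Sol_inf m a f \<sigma> b) + Z" using y by (simp add: add.assoc)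
    qed
  qed
qed

end
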